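(* Let $k$ be an integer and let $(E_N)_{N\in\mathbb{N}}$ be an element of $\prod_{N=1}^{\infty}\mathbb{C}[\mathcal{P}_k(N)]$. The sequence $(E_N)_{N\in\mathbb{N}}$ converges in moments if and only if for any $p\in\mathcal{P}_k$, $\kappa_p(E_N)$ converges as $N$ goes to infinity, to a number denoted by $\kappa_p(E)$. If $(E_N)_{N\in\mathbb{N}}$ converges in moments, then for any $p\in\mathcal{P}_k$, $$m_p(E)=\sum_{p'\leq p}\kappa_{p'}(E).$$
   Context: $\mathcal{P}_k$ is the set of partitions of $\{1,\dots,k\}\cup\{1',\dots,k'\}$ ($1,\dots,k$ top row, $1',\dots,k'$ bottom row), $\mathrm{id}_k=\{\{i,i'\}:1\le i\le k\}$. $\mathrm{nc}(p)$ is the number of blocks, $p\vee p'$ the finest partition coarser than both, $d(p,p')=\frac12(\mathrm{nc}(p)+\mathrm{nc}(p'))-\mathrm{nc}(p\vee p')$, and $p'\leq p$ if $d(\mathrm{id}_k,p')+d(p',p)=d(\mathrm{id}_k,p)$. Composition: $p\circ p'$ is obtained by putting a diagram of $p'$ above one of $p$, identifying the bottom vertex $i'$ of $p'$ with the top vertex $i$ of $p$, and taking the partition of top and bottom rows induced by the connected components; $\kappa(p,p')$ is the number of connected components entirely contained in the middle row. ${}^tp$ is $p$ with $i$ and $i'$ exchanged for all $i$. For a positive integer $N$, the partition algebra $\mathbb{C}[\mathcal{P}_k(N)]$ has basis $\mathcal{P}_k$ and product $p_1p_2=N^{\kappa(p_1,p_2)}(p_1\circ p_2)$. $\mathrm{Tr}_N$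 is the linear form on it with $\mathrm{Tr}_N(p)=N^{\mathrm{nc}(p\vee\mathrm{id}_k)}$ (the trace in the natural representation on $(\mathbb{C}^N)^{\otimes k}$). For $E\in\mathbb{C}[\mathcal{P}_k(N)]$ and $p\in\mathcal{P}_k$: the $p$-moment is $m_p(E)=\frac{1}{\mathrm{Tr}_N(p)}\mathrm{Tr}_N(E\,{}^tp)$; the cumulant on $p$ is $\kappa_p(E)=N^{\mathrm{nc}(p)-\mathrm{nc}(p\vee\mathrm{id}_k)}E_p$, where $E=\sum_pE_p\,p$. A sequence $(E_N)_N$ converges in moments if $m_p(E_N)$ converges as $N\to\infty$ for every $p\in\mathcal{P}_k$; the limit is denoted $m_p(E)$. *)

theory Defs
  imports "HOL-Analysis.Analysis" "HOL-Library.Disjoint_Sets"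
begin

text \<open>The vertices \<open>i\<close> and \<open>i'\<close> are \<open>Top i\<close> and \<open>Bot i\<close>.\<close>

datatype vertex = Top nat | Bot nat

definition vertices :: "nat \<Rightarrow> vertex set" where
  "vertices k = Top ` {1..k} \<union> Bot ` {1..k}"

definition partitions :: "nat \<Rightarrow> vertex set set set" where
  "partitions k = {p. partition_on (vertices k) p}"

definition id_part :: "nat \<Rightarrow> vertex set set" where
  "id_part k = (\<lambda>i. {Top i, Bot i}) ` {1..k}"

definition nc :: "vertex set set \<Rightarrow> nat" where
  "nc p = card p"

definition join_part :: "nat \<Rightarrow> vertex set set \<Rightarrow> vertex set set \<Rightarrow> vertex set set" where
  "join_part k p p' = (THE q.
     refines (vertices k) p q \<and> refines (vertices k) p' q \<and>
     (\<forall>r. refines (vertices k) p r \<and> refines (vertices k) p' r \<longrightarrow> refines (vertices k) q r))"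

definition dist_part :: "nat \<Rightarrow> vertex set set \<Rightarrow> vertex set set \<Rightarrow> real" where
  "dist_part k p p' = (real (nc p) + real (nc p')) / 2 - real (nc (join_part k p p'))"

definition geodesic_le :: "nat \<Rightarrow> vertex set set \<Rightarrow> vertex set set \<Rightarrow> bool" where
  "geodesic_le k p' p \<longleftrightarrow>
     dist_part k (id_part k) p' + dist_part k p' p = dist_part k (id_part k) p"

fun flip_vertex :: "vertex \<Rightarrow> vertex" where
  "flip_vertex (Top i) = Bot i"
| "flip_vertex (Bot i) = Top i"

definition transpose_part :: "vertex set set \<Rightarrow> vertex set set" where
  "transpose_part p = (\<lambda>B. flip_vertex ` B) ` p"

text \<open>
  For \<open>p \<circ> p'\<close> a diagram of \<open>p'\<close> is put above a diagram of \<open>p\<close>: \<open>p'\<close> lives on the rows \<open>Upper\<close>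
  and \<open>Middle\<close>, and \<open>p\<close> on the rows \<open>Middle\<close> and \<open>Lower\<close>.
\<close>

datatype stacked = Upper nat | Middle nat | Lower nat

fun place_above :: "vertex \<Rightarrow> stacked" where
  "place_above (Top i) = Upper i"
| "place_above (Bot i) = Middle i"

fun place_below :: "vertex \<Rightarrow> stacked" where
  "place_below (Top i) = Middle i"
| "place_below (Bot i) = Lower i"

fun place_outer :: "vertex \<Rightarrow> stacked" where
  "place_outer (Top i) = Upper i"
| "place_outer (Bot i) = Lower i"

definition stacked_vertices :: "nat \<Rightarrow> stacked set" where
  "stacked_vertices k = Upper ` {1..k} \<union> Middle ` {1..k} \<union> Lower ` {1..k}"

definition stacked_edges :: "vertex set set \<Rightarrow> vertex set set \<Rightarrow> (stacked \<times> stacked) set" where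
  "stacked_edges p p' =
     (\<Union>B\<in>p'. (place_above ` B) \<times> (place_above ` B)) \<union>
     (\<Union>B\<in>p. (place_below ` B) \<times> (place_below ` B))"

definition stacked_components ::
  "nat \<Rightarrow> vertex set set \<Rightarrow> vertex set set \<Rightarrow> stacked set set" where
  "stacked_components k p p' = stacked_vertices k // (stacked_edges p p')\<^sup>*"

definition comp_part :: "nat \<Rightarrow> vertex set set \<Rightarrow> vertex set set \<Rightarrow> vertex set set" where
  "comp_part k p p' = (\<lambda>C. place_outer -` C) ` stacked_components k p p' - {{}}"

definition loops :: "nat \<Rightarrow> vertex set set \<Rightarrow> vertex set set \<Rightarrow> nat" where
  "loops k p p' = card {C \<in> stacked_components k p p'. C \<subseteq> Middle ` {1..k}}"

text \<open>An element \<open>E\<close> is represented by its family of coordinates \<open>E p\<close> in the basis of partitions.\<close>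

type_synonym part_vec = "vertex set set \<Rightarrow> complex"

definition part_algebra :: "nat \<Rightarrow> part_vec set" where
  "part_algebra k = {E. \<forall>p. p \<notin> partitions k \<longrightarrow> E p = 0}"

definition basis_vec :: "vertex set set \<Rightarrow> part_vec" where
  "basis_vec p = (\<lambda>q. if q = p then 1 else 0)"

text \<open>The bilinear extension of \<open>p\<^sub>1 p\<^sub>2 = N ^ loops k p\<^sub>1 p\<^sub>2 \<cdot> (p\<^sub>1 \<circ> p\<^sub>2)\<close>.\<close>

definition part_mult :: "nat \<Rightarrow> nat \<Rightarrow> part_vec \<Rightarrow> part_vec \<Rightarrow> part_vec" where
  "part_mult k N E F = (\<lambda>q. \<Sum>p\<^sub>1\<in>partitions k. \<Sum>p\<^sub>2\<in>partitions k.
     E p\<^sub>1 * F p\<^sub>2 * (of_nat N ^ loops k p\<^sub>1 p\<^sub>2 * basis_vec (comp_part k p\<^sub>1 p\<^sub>2) q))"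

definition Tr_part :: "nat \<Rightarrow> nat \<Rightarrow> part_vec \<Rightarrow> complex" where
  "Tr_part k N E = (\<Sum>p\<in>partitions k. E p * of_nat N ^ nc (join_part k p (id_part k)))"

definition moment :: "nat \<Rightarrow> nat \<Rightarrow> vertex set set \<Rightarrow> part_vec \<Rightarrow> complex" where
  "moment k N p E =
     1 / Tr_part k N (basis_vec p) * Tr_part k N (part_mult k N E (basis_vec (transpose_part p)))"

definition cumulant :: "nat \<Rightarrow> nat \<Rightarrow> vertex set set \<Rightarrow> part_vec \<Rightarrow> complex" where
  "cumulant k N p E = of_nat N powi (int (nc p) - int (nc (join_part k p (id_part k)))) * E p"

definition converges_in_moments :: "nat \<Rightarrow> (nat \<Rightarrow> part_vec) \<Rightarrow> bool" where
  "converges_in_moments k E \<longleftrightarrow> (\<forall>p\<in>partitions k. convergent (\<lambda>N. moment k N p (E N)))"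

definition limit_moment :: "nat \<Rightarrow> (nat \<Rightarrow> part_vec) \<Rightarrow> vertex set set \<Rightarrow> complex" where
  "limit_moment k E p = lim (\<lambda>N. moment k N p (E N))"

definition limit_cumulant :: "nat \<Rightarrow> (nat \<Rightarrow> part_vec) \<Rightarrow> vertex set set \<Rightarrow> complex" where
  "limit_cumulant k E p = lim (\<lambda>N. cumulant k N p (E N))"

end

theory Submission
  imports Defs
begin

text \<open>
  Closing up the diagram of a product shows \<open>Tr\<^sub>N(p' \<^sup>tp) = N ^ nc(p' \<or> p)\<close>, so that
  \<open>m\<^sub>p(E\<^sub>N) = \<Sum>\<^sub>p\<^sub>' N ^ (- \<delta>(p', p)) \<kappa>\<^sub>p\<^sub>'(E\<^sub>N)\<close> with
  \<open>\<delta>(p', p) = d(id, p') + d(p', p) - d(id, p)\<close>.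
  This defect is a natural number because the number of connected components of a graph is a
  supermodular function of its edge set. Hence the matrix of the system tends to the 0-1 matrix of
  \<open>p' \<le> p\<close>, which is unitriangular for the rank \<open>d(id, p)\<close>, and convergence of the
  moments can be transferred to the cumulants by Gaussian elimination.
\<close>

section \<open>Connected components\<close>

text \<open>The equivalence relation generated by \<open>R\<close>, taken on the whole type so that
  no membership side conditions arise; vertex sets enter only through quotients
  \<open>V // conn R\<close>.\<close>

definition conn :: "('a \<times> 'a) set \<Rightarrow> ('a \<times> 'a) set" where
  "conn R = (R \<union> R\<inverse>)\<^sup>*"

text \<open>Only classes of points of \<open>V\<close> are counted, but walks may leave
  \<open>V\<close>. This is used for the outer rows inside the stacked diagram.\<close>

definition ncomp :: "'a set \<Rightarrow> ('a \<times> 'a) set \<Rightarrow> nat" where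
  "ncomp V R = card (V // conn R)"

lemma conn_refl [simp]: "(x, x) \<in> conn R"
  by (simp add: conn_def)

lemma conn_sym: "(x, y) \<in> conn R \<Longrightarrow> (y, x) \<in> conn R"
  unfolding conn_def by (rule symD[OF sym_rtrancl[OF sym_Un_converse]])

lemma conn_trans [trans]: "(x, y) \<in> conn R \<Longrightarrow> (y, z) \<in> conn R \<Longrightarrow> (x, z) \<in> conn R"
  unfolding conn_def by (rule rtrancl_trans)

lemma conn_base: "(x, y) \<in> R \<Longrightarrow> (x, y) \<in> conn R"
  unfolding conn_def by auto

lemma conn_base_sym: "(y, x) \<in> R \<Longrightarrow> (x, y) \<in> conn R"
  by (rule conn_sym[OF conn_base])

lemma conn_mono: "R \<subseteq> S \<Longrightarrow> conn R \<subseteq> conn S"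
  unfolding conn_def by (intro rtrancl_mono) auto

lemma equiv_conn: "equiv UNIV (conn R)"
  by (intro equivI refl_onI symI transI) (simp, simp, erule conn_sym, erule conn_trans)

lemma conn_Image_eq_iff: "conn R `` {x} = conn R `` {y} \<longleftrightarrow> (x, y) \<in> conn R"
  by (rule eq_equiv_class_iff[OF equiv_conn]) simp_all

lemma conn_induct [consumes 1, case_names refl step]:
  assumes "(x, y) \<in> conn R" and "P x"
    and "\<And>u v. (x, u) \<in> conn R \<Longrightarrow> P u \<Longrightarrow> (u, v) \<in> R \<or> (v, u) \<in> R \<Longrightarrow> P v"
  shows "P y"
  using assms(1) unfolding conn_def
proof (induction rule: rtrancl_induct)
  case base
  then show ?case by (fact assms(2))
next
  case (step u v)
  then show ?case using assms(3)[of u v] by (auto simp: conn_def)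
qed

lemma conn_subset:
  assumes "R \<subseteq> conn S"
  shows "conn R \<subseteq> conn S"
proof (rule subrelI)
  fix x y assume "(x, y) \<in> conn R"
  then show "(x, y) \<in> conn S"
  proof (induction rule: conn_induct)
    case (step u v)
    from step.hyps(2) have "(u, v) \<in> conn S"
      using assms conn_sym[of v u S] by blast
    then show ?case by (rule conn_trans[OF step.IH])
  qed simp
qed

lemma conn_sym_eq: "sym R \<Longrightarrow> conn R = R\<^sup>*"
  unfolding conn_def sym_conv_converse_eq by simp

text \<open>Equal kernels make the assignment of \<open>h x\<close> to \<open>g x\<close> well
  defined and bijective.\<close>

lemma card_image_eq_kernel:
  assumes "\<And>x y. x \<in> V \<Longrightarrow> y \<in> V \<Longrightarrow> g x = g y \<longleftrightarrow> h x = h y"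
  shows "card (g ` V) = card (h ` V)"
proof (rule bij_betw_same_card)
  let ?f = "\<lambda>c. h (inv_into V g c)"
  have eq: "?f (g x) = h x" if "x \<in> V" for x
    using assms[of "inv_into V g (g x)" x] that by (simp add: f_inv_into_f inv_into_into)
  show "bij_betw ?f (g ` V) (h ` V)"
  proof (rule bij_betw_imageI)
    show "inj_on ?f (g ` V)"
      using assms eq by (auto simp: inj_on_def)
    show "?f ` g ` V = h ` V"
      using eq by (force simp: image_iff)
  qed
qed

text \<open>The map induced by \<open>f\<close> on classes is injective by \<open>iff\<close> and
  surjective by \<open>surj\<close>, although \<open>f\<close> itself may be neither. All
  comparisons of component counts between different diagrams go through this.\<close>

lemma card_quotient_eq:
  assumes "\<And>x. x \<in> V \<Longrightarrow> f x \<in> W"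
    and iff: "\<And>x y. x \<in> V \<Longrightarrow> y \<in> V \<Longrightarrow> (x, y) \<in> conn R \<longleftrightarrow> (f x, f y) \<in> conn S"
    and surj: "\<And>w. w \<in> W \<Longrightarrow> \<exists>x\<in>V. (f x, w) \<in> conn S"
  shows "card (V // conn R) = card (W // conn S)"
proof -
  have "W // conn S = (\<lambda>x. conn S `` {f x}) ` V"
  proof (intro subset_antisym subsetI)
    fix C assume "C \<in> W // conn S"
    then obtain w where w: "w \<in> W" "C = conn S `` {w}" by (auto simp: quotient_def)
    from surj[OF w(1)] obtain x where "x \<in> V" "(f x, w) \<in> conn S" by auto
    then have "x \<in> V" "C = conn S `` {f x}" using w(2) by (simp_all add: conn_Image_eq_iff conn_sym)
    then show "C \<in> (\<lambda>x. conn S `` {f x}) ` V" by (rule rev_image_eqI)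
  qed (use assms(1) in \<open>auto simp: quotient_def\<close>)
  moreover have "V // conn R = (\<lambda>x. conn R `` {x}) ` V"
    by (auto simp: quotient_def)
  moreover have "card ((\<lambda>x. conn R `` {x}) ` V) = card ((\<lambda>x. conn S `` {f x}) ` V)"
    by (rule card_image_eq_kernel) (unfold conn_Image_eq_iff, rule iff)
  ultimately show ?thesis by simp
qed

text \<open>A walk can be shortened until it uses the new edge at most once, in one of its two
  directions.\<close>

lemma conn_insert:
  assumes "(x, y) \<in> conn (insert (a, b) R)"
  shows "(x, y) \<in> conn R \<or> (x, a) \<in> conn R \<and> (b, y) \<in> conn R \<or> (x, b) \<in> conn R \<and> (a, y) \<in> conn R"
  using assms
proof (induction rule: conn_induct)
  case (step u v)
  from step.hyps(2) consider "(u, v) \<in> conn R" | "u = a" "v = b" | "u = b" "v = a"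
    by (auto intro: conn_base conn_base_sym)
  then show ?case
  proof cases
    case 1
    with step.IH show ?thesis by (auto intro: conn_trans[OF _ 1])
  next
    case 2
    with step.IH show ?thesis by auto
  next
    case 3
    with step.IH show ?thesis by auto
  qed
qed simp

text \<open>A new edge either joins two classes or lies within one.\<close>

lemma ncomp_insert:
  assumes "finite V" "a \<in> V" "b \<in> V"
  shows "ncomp V R = ncomp V (insert (a, b) R) + (if (a, b) \<in> conn R then 0 else 1)"
proof (cases "(a, b) \<in> conn R")
  case True
  then have "conn (insert (a, b) R) \<subseteq> conn R"
    by (intro conn_subset) (auto intro: conn_base)
  then have "conn (insert (a, b) R) = conn R"
    using conn_mono[of R "insert (a, b) R"] by blast
  with True show ?thesis by (simp add: ncomp_def)
next
  case False
  \<comment> \<open>Outside the class of \<open>b\<close> the new edge creates no connection, and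
    \<open>a\<close> remains there to represent the merged class. So \<open>?V\<close> meets every
    new class and has exactly one old class fewer than \<open>V\<close>.\<close>
  let ?S = "insert (a, b) R" and ?V = "V - conn R `` {b}"
  have ab: "(a, b) \<in> conn ?S" by (simp add: conn_base)
  have RS: "conn R \<subseteq> conn ?S" by (rule conn_mono) auto
  have a: "a \<in> ?V" using assms False conn_sym by fastforce
  have "card (?V // conn R) = card (V // conn ?S)"
  proof (rule card_quotient_eq[where f = "\<lambda>x. x"])
    show "(x, y) \<in> conn R \<longleftrightarrow> (x, y) \<in> conn ?S" if "x \<in> ?V" "y \<in> ?V" for x y
      using that RS conn_insert[of x y a b R] conn_sym[of x b R] by auto
    show "\<exists>x\<in>?V. (x, w) \<in> conn ?S" if "w \<in> V" for w
    proof (cases "w \<in> ?V")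
      case True
      then show ?thesis by force
    next
      case False
      then have "(b, w) \<in> conn ?S" using that RS by auto
      then show ?thesis using a ab conn_trans by metis
    qed
  qed auto
  moreover have "V // conn R = insert (conn R `` {b}) (?V // conn R)"
  proof (intro subset_antisym subsetI)
    fix C assume "C \<in> V // conn R"
    then obtain x where "x \<in> V" "C = conn R `` {x}" by (auto simp: quotient_def)
    then show "C \<in> insert (conn R `` {b}) (?V // conn R)"
      using conn_sym[of b x R] by (cases "x \<in> ?V") (auto simp: quotient_def conn_Image_eq_iff)
  qed (use assms in \<open>auto simp: quotient_def\<close>)
  moreover have "conn R `` {b} \<notin> ?V // conn R"
    by (auto simp: quotient_def conn_Image_eq_iff)
  moreover have "finite (?V // conn R)"
    using assms(1) by (simp add: quotient_def)
  ultimately show ?thesis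
    using False by (simp add: ncomp_def)
qed

text \<open>Sending each class of \<open>R\<close> to the class of \<open>S\<close> containing it is
  surjective.\<close>

lemma ncomp_mono:
  assumes "finite V" "R \<subseteq> conn S"
  shows "ncomp V S \<le> ncomp V R"
proof -
  have "conn R \<subseteq> conn S" using assms by (intro conn_subset)
  then have "(\<lambda>C. conn S `` C) ` (V // conn R) = V // conn S"
  proof -
    have "conn S `` (conn R `` {x}) = conn S `` {x}" for x
      using \<open>conn R \<subseteq> conn S\<close> conn_trans[of x _ S] conn_refl[of x R] by blast
    then show ?thesis by (simp add: quotient_def image_UN)
  qed
  moreover have "finite (V // conn R)" using assms by (simp add: quotient_def)
  ultimately show ?thesis unfolding ncomp_def by (metis card_image_le)
qed

text \<open>The equality case of monotonicity: an edge of \<open>S\<close> between different classes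
  of \<open>R\<close> would already lower the count by one.\<close>

lemma ncomp_Un_eqD:
  assumes "finite V" "S \<subseteq> V \<times> V" "ncomp V (R \<union> S) = ncomp V R"
  shows "S \<subseteq> conn R"
proof (rule subrelI, rule ccontr)
  fix a b assume ab: "(a, b) \<in> S" "(a, b) \<notin> conn R"
  then have "ncomp V R = ncomp V (insert (a, b) R) + 1"
    using ncomp_insert[of V a b R] assms by auto
  moreover have "ncomp V (R \<union> S) \<le> ncomp V (insert (a, b) R)"
    using ab assms(1) by (intro ncomp_mono) (auto intro: conn_base)
  ultimately show False using assms(3) by simp
qed

text \<open>Add the edges of \<open>S\<close> one by one. An edge that merges classes in the
  presence of \<open>T\<close> also merges classes without \<open>T\<close>, so the count for
  \<open>R \<union> S\<close> drops at least as often as the count for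
  \<open>R \<union> T \<union> S\<close>.\<close>

lemma ncomp_supermodular:
  assumes "finite V" "S \<subseteq> V \<times> V"
  shows "ncomp V (R \<union> T) + ncomp V (R \<union> S) \<le> ncomp V R + ncomp V (R \<union> T \<union> S)"
proof -
  have "finite S" using assms by (meson finite_SigmaI finite_subset)
  then show ?thesis using assms(2)
  proof (induction S rule: finite_induct)
    case (insert e S)
    obtain a b where e: "e = (a, b)" by (cases e)
    have ab: "a \<in> V" "b \<in> V" using insert.prems e by auto
    have "conn (R \<union> S) \<subseteq> conn (R \<union> T \<union> S)" by (rule conn_mono) auto
    with ncomp_insert[OF assms(1) ab, of "R \<union> S"] ncomp_insert[OF assms(1) ab, of "R \<union> T \<union> S"]
      insert.IH insert.prems e
    show ?case by (auto split: if_splits)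
  qed simp
qed

lemma conn_restrict:
  assumes T: "T \<subseteq> V \<times> V" and xy: "x \<in> V" "y \<in> V"
  shows "(f x, f y) \<in> conn (R \<union> map_prod f f ` T) \<longleftrightarrow>
         (x, y) \<in> conn ({(u, v). u \<in> V \<and> v \<in> V \<and> (f u, f v) \<in> conn R} \<union> T)"
    (is "?L \<longleftrightarrow> _ \<in> conn ?S")
proof
  assume ?L
  then have "\<exists>z\<in>V. (x, z) \<in> conn ?S \<and> (f z, f y) \<in> conn R"
  proof (induction rule: conn_induct)
    case refl
    then show ?case using xy by force
  next
    case (step u v)
    then obtain z where z: "z \<in> V" "(x, z) \<in> conn ?S" "(f z, u) \<in> conn R" by auto
    consider "(u, v) \<in> conn R" | c d where "u = f c" "v = f d" "(c, d) \<in> T \<or> (d, c) \<in> T"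
      using step.hyps(2) by (auto intro: conn_base conn_base_sym)
    then show ?case
    proof cases
      case 1
      then show ?thesis using z by (meson conn_trans)
    next
      case 2
      then have cd: "c \<in> V" "d \<in> V" "(c, d) \<in> conn ?S"
        using T by (auto intro: conn_base conn_base_sym)
      have "(z, c) \<in> conn ?S" using z cd 2 by (intro conn_base) auto
      then show ?thesis using z cd 2 by (meson conn_refl conn_trans)
    qed
  qed
  then obtain z where z: "z \<in> V" "(x, z) \<in> conn ?S" "(f z, f y) \<in> conn R" by auto
  then have "(z, y) \<in> conn ?S" using xy by (intro conn_base) auto
  with z show "(x, y) \<in> conn ?S" by (meson conn_trans)
next
  have RR: "conn R \<subseteq> conn (R \<union> map_prod f f ` T)" by (rule conn_mono) auto
  assume "(x, y) \<in> conn ?S"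
  then show ?L
  proof (induction rule: conn_induct)
    case (step u v)
    from step.hyps(2) consider "(f u, f v) \<in> conn R" | "(u, v) \<in> T" | "(v, u) \<in> T"
      using conn_sym[of "f v" "f u" R] by blast
    then have "(f u, f v) \<in> conn (R \<union> map_prod f f ` T)"
    proof cases
      case 1
      then show ?thesis using RR by auto
    next
      case 2
      then show ?thesis by (intro conn_base UnI2 rev_image_eqI[of "(u, v)"]) simp_all
    next
      case 3
      then show ?thesis by (intro conn_base_sym UnI2 rev_image_eqI[of "(v, u)"]) simp_all
    qed
    with step show ?case by (meson conn_trans)
  qed simp
qed

text \<open>Identifying vertices that are already connected does not change connectivity.\<close>

lemma conn_contract:
  assumes "R \<subseteq> V \<times> V" "x \<in> V" "y \<in> V"
    and ker: "\<And>x y. x \<in> V \<Longrightarrow> y \<in> V \<Longrightarrow> f x = f y \<Longrightarrow> (x, y) \<in> conn R"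
  shows "(x, y) \<in> conn R \<longleftrightarrow> (f x, f y) \<in> conn (map_prod f f ` R)"
proof
  assume "(x, y) \<in> conn R"
  then show "(f x, f y) \<in> conn (map_prod f f ` R)"
  proof (induction rule: conn_induct)
    case (step u v)
    have "(f u, f v) \<in> map_prod f f ` R \<or> (f v, f u) \<in> map_prod f f ` R"
      using step.hyps(2) by force
    then have "(f u, f v) \<in> conn (map_prod f f ` R)"
      using conn_base conn_base_sym by metis
    with step show ?case by (meson conn_trans)
  qed simp
next
  assume "(f x, f y) \<in> conn (map_prod f f ` R)"
  \<comment> \<open>All preimages are covered at once: consecutive edges of the contracted walk may
    lift to edges with different endpoints over the same point, which \<open>ker\<close>
    reconnects.\<close>
  then have "\<forall>z\<in>V. f z = f y \<longrightarrow> (x, z) \<in> conn R"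
  proof (induction rule: conn_induct)
    case refl
    then show ?case using ker assms(2) by simp
  next
    case (step u v)
    then obtain c d where cd: "u = f c" "v = f d" "(c, d) \<in> R \<or> (d, c) \<in> R" by auto
    then have "c \<in> V" "d \<in> V" "(c, d) \<in> conn R"
      using assms(1) by (auto intro: conn_base conn_base_sym)
    then show ?case using step.IH cd ker by (metis conn_trans)
  qed
  then show "(x, y) \<in> conn R" using assms(3) by simp
qed

lemma conn_class_avoiding:
  assumes "J \<subseteq> W \<times> W" "conn R `` {x} \<inter> W = {}"
  shows "conn (R \<union> J) `` {x} = conn R `` {x}"
proof -
  have "(x, y) \<in> conn R" if "(x, y) \<in> conn (R \<union> J)" for y
    using that
  proof (induction rule: conn_induct)
    case (step u v)
    then have "u \<notin> W" using assms(2) by auto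
    then have "(u, v) \<in> conn R"
      using step.hyps(2) assms(1) by (auto intro: conn_base conn_base_sym)
    then show ?case by (rule conn_trans[OF step.IH])
  qed simp
  moreover have "conn R \<subseteq> conn (R \<union> J)" by (rule conn_mono) auto
  ultimately show ?thesis by auto
qed

text \<open>Classes avoiding \<open>W\<close> are untouched by edges inside \<open>W\<close>; all
  others have a representative in \<open>W\<close>. With \<open>W\<close> the outer rows, the first
  kind are the loops of a composition.\<close>

lemma ncomp_Un_split:
  assumes "finite V" "W \<subseteq> V" "J \<subseteq> W \<times> W"
  shows "ncomp V (R \<union> J) = card {C \<in> V // conn R. C \<inter> W = {}} + ncomp W (R \<union> J)"
proof -
  let ?A = "{C \<in> V // conn R. C \<inter> W = {}}" and ?B = "W // conn (R \<union> J)"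
  note avoid = conn_class_avoiding[OF assms(3), of R]
  have "V // conn (R \<union> J) = ?A \<union> ?B"
  proof (intro subset_antisym subsetI)
    fix C assume "C \<in> V // conn (R \<union> J)"
    then obtain x where x: "x \<in> V" "C = conn (R \<union> J) `` {x}" by (auto simp: quotient_def)
    show "C \<in> ?A \<union> ?B"
    proof (cases "C \<inter> W = {}")
      case True
      have "conn R `` {x} \<subseteq> C" using conn_mono[of R "R \<union> J"] x(2) by auto
      then have "C = conn R `` {x}" using avoid[of x] x(2) True by auto
      then show ?thesis using x(1) True by (auto intro: quotientI)
    next
      case False
      then obtain y where "y \<in> W" "(x, y) \<in> conn (R \<union> J)" using x(2) by auto
      then have "C = conn (R \<union> J) `` {y}" using x(2) by (simp add: conn_Image_eq_iff)
      with \<open>y \<in> W\<close> show ?thesis by (auto intro: quotientI)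
    qed
  next
    fix C assume "C \<in> ?A \<union> ?B"
    then show "C \<in> V // conn (R \<union> J)"
    proof
      assume "C \<in> ?A"
      then obtain x where "x \<in> V" "C = conn R `` {x}" "C \<inter> W = {}"
        by (auto simp: quotient_def)
      then have "C = conn (R \<union> J) `` {x}" using avoid[of x] by simp
      with \<open>x \<in> V\<close> show ?thesis by (auto intro: quotientI)
    next
      assume "C \<in> ?B"
      then show ?thesis using assms(2) by (auto simp: quotient_def)
    qed
  qed
  moreover have "?A \<inter> ?B = {}"
    by (auto simp: quotient_def)
  moreover have "finite W" using assms by (metis finite_subset)
  ultimately show ?thesis
    using assms(1) by (simp add: ncomp_def card_Un_disjoint quotient_def)
qed

section \<open>Partitions as equivalence relations\<close>

text \<open>Encodes a partition as a graph of cliques, so that refinement becomes inclusion and the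
  join becomes connectivity in a union.\<close>

definition block_rel :: "'a set set \<Rightarrow> ('a \<times> 'a) set" where
  "block_rel p = (\<Union>B\<in>p. B \<times> B)"

lemma sym_block_rel: "sym (block_rel p)"
  by (auto simp: block_rel_def sym_def)

lemma equiv_block_rel:
  assumes "partition_on V p"
  shows "equiv V (block_rel p)"
proof -
  have "block_rel p = {(x, y). \<exists>B\<in>p. x \<in> B \<and> y \<in> B}" by (auto simp: block_rel_def)
  then show ?thesis using equiv_partition_on[OF assms] by simp
qed

lemma block_rel_subset: "partition_on V p \<Longrightarrow> block_rel p \<subseteq> V \<times> V"
  by (auto simp: block_rel_def partition_on_def)

text \<open>For the converse, one point of a block, which exists since blocks are nonempty,
  determines the block of \<open>q\<close> that must contain the rest.\<close>

lemma refines_iff_block_rel: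
  assumes p: "partition_on V p" and q: "partition_on V q"
  shows "refines V p q \<longleftrightarrow> block_rel p \<subseteq> block_rel q"
proof
  show "refines V p q \<Longrightarrow> block_rel p \<subseteq> block_rel q"
    unfolding refines_def block_rel_def by (blast dest: subsetD)
next
  assume sub: "block_rel p \<subseteq> block_rel q"
  have "\<exists>Y\<in>q. X \<subseteq> Y" if X: "X \<in> p" for X
  proof -
    obtain x where x: "x \<in> X" using X p by (metis partition_onD3 ex_in_conv)
    then obtain Y where Y: "Y \<in> q" "x \<in> Y"
      using X p q by (metis UnionE UnionI partition_onD1)
    have "y \<in> Y" if "y \<in> X" for y
    proof -
      have "(x, y) \<in> block_rel q" using X x that sub by (auto simp: block_rel_def)
      then obtain Z where "Z \<in> q" "x \<in> Z" "y \<in> Z" by (auto simp: block_rel_def)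
      then show ?thesis using Y q by (auto simp: partition_on_def disjoint_def)
    qed
    then show ?thesis using Y by auto
  qed
  then show "refines V p q" using p q by (simp add: refines_def)
qed

lemma block_rel_inject:
  assumes "partition_on V p" "partition_on V q" "block_rel p = block_rel q"
  shows "p = q"
proof (rule refines_asym)
  show "refines V p q" "refines V q p" using assms by (simp_all add: refines_iff_block_rel)
qed

text \<open>An equivalence relation containing \<open>R\<close> contains the one generated by
  \<open>R\<close>; the intersection discards the diagonal outside \<open>V\<close>, which
  \<open>conn\<close> includes.\<close>

lemma conn_Int_block_rel:
  assumes "partition_on V p" "R \<subseteq> block_rel p"
  shows "conn R \<inter> V \<times> V \<subseteq> block_rel p"
proof (rule subrelI)
  fix x y assume xy: "(x, y) \<in> conn R \<inter> V \<times> V"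
  then have "(x, y) \<in> conn R" by simp
  then show "(x, y) \<in> block_rel p"
  proof (induction rule: conn_induct)
    case refl
    then show ?case using xy equiv_block_rel[OF assms(1)] by (auto simp: equiv_def refl_on_def)
  next
    case (step u v)
    then have "(u, v) \<in> block_rel p"
      using assms(2) sym_block_rel[of p] by (auto dest: symD)
    with step.IH show ?case
      using equiv_block_rel[OF assms(1)] by (meson equivE transD)
  qed
qed

lemma partition_on_components:
  assumes "R \<subseteq> V \<times> V"
  shows "partition_on V (V // conn R)" and "block_rel (V // conn R) = conn R \<inter> V \<times> V"
proof -
  have cl: "y \<in> V" if "(x, y) \<in> conn R" "x \<in> V" for x y
    using that by (induction rule: conn_induct) (use assms in auto)
  show "partition_on V (V // conn R)"
  proof (rule partition_onI)
    show "\<Union> (V // conn R) = V"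
    proof (intro subset_antisym subsetI)
      show "x \<in> V" if "x \<in> \<Union> (V // conn R)" for x
        using that by (auto simp: quotient_def intro: cl)
      show "x \<in> \<Union> (V // conn R)" if "x \<in> V" for x
        using that by (intro UnionI[of "conn R `` {x}"] quotientI) auto
    qed
    show "disjnt C D" if "C \<in> V // conn R" "D \<in> V // conn R" "C \<noteq> D" for C D
    proof -
      from that obtain x y where "C = conn R `` {x}" "D = conn R `` {y}"
        by (auto simp: quotient_def)
      then show ?thesis
        using that(3) by (simp add: disjnt_equiv_class[OF equiv_conn] conn_Image_eq_iff)
    qed
    show "{} \<notin> V // conn R"
      using conn_refl[of _ R] unfolding quotient_def by blast
  qed
  show "block_rel (V // conn R) = conn R \<inter> V \<times> V"
  proof (intro subset_antisym subrelI)
    fix x y assume "(x, y) \<in> block_rel (V // conn R)"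
    then obtain z where z: "z \<in> V" "(z, x) \<in> conn R" "(z, y) \<in> conn R"
      by (auto simp: block_rel_def quotient_def)
    then have "x \<in> V" "y \<in> V" by (auto intro: cl)
    moreover have "(x, y) \<in> conn R" using z conn_sym conn_trans by metis
    ultimately show "(x, y) \<in> conn R \<inter> V \<times> V" by simp
  next
    fix x y assume "(x, y) \<in> conn R \<inter> V \<times> V"
    then show "(x, y) \<in> block_rel (V // conn R)"
      unfolding block_rel_def by (intro UN_I[of "conn R `` {x}"]) (auto intro: quotientI)
  qed
qed

lemma quotient_conn_block_rel:
  assumes "partition_on V p"
  shows "V // conn (block_rel p) = p"
proof (rule block_rel_inject)
  note sub = block_rel_subset[OF assms]
  show "partition_on V (V // conn (block_rel p))" by (rule partition_on_components[OF sub])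
  show "block_rel (V // conn (block_rel p)) = block_rel p"
    using conn_Int_block_rel[OF assms order.refl] sub
    by (auto simp: partition_on_components[OF sub] intro: conn_base)
qed (rule assms)

section \<open>Joins and distances for partitions of the two rows\<close>

lemma finite_vertices [simp]: "finite (vertices k)"
  by (simp add: vertices_def)

lemma finite_partitions [simp]: "finite (partitions k)"
  unfolding partitions_def by (rule finitely_many_partition_on) simp

lemma partitionsD: "p \<in> partitions k \<Longrightarrow> partition_on (vertices k) p"
  by (simp add: partitions_def)

lemma partitions_block_rel_subset: "p \<in> partitions k \<Longrightarrow> block_rel p \<subseteq> vertices k \<times> vertices k"
  by (rule block_rel_subset[OF partitionsD])

lemma id_part_in_partitions: "id_part k \<in> partitions k"
  by (auto simp: partitions_def partition_on_def id_part_def vertices_def disjoint_def)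

text \<open>The components are refined by \<open>p\<close> and \<open>q\<close>, and they refine
  every common coarsening because its block relation is an equivalence containing both. Antisymmetry
  of refinement makes the description unique.\<close>

lemma join_part_eq:
  assumes "p \<in> partitions k" "q \<in> partitions k"
  shows "join_part k p q = vertices k // conn (block_rel p \<union> block_rel q)"
proof -
  let ?R = "block_rel p \<union> block_rel q"
  have sub: "?R \<subseteq> vertices k \<times> vertices k"
    using assms partitions_block_rel_subset by blast
  note comp = partition_on_components[OF sub]
  note pq = partitionsD[OF assms(1)] partitionsD[OF assms(2)]
  have upper: "refines (vertices k) p (vertices k // conn ?R)" "refines (vertices k) q (vertices k // conn ?R)"
    using sub by (auto simp: refines_iff_block_rel pq comp intro: conn_base)
  have least: "refines (vertices k) (vertices k // conn ?R) r"
    if "refines (vertices k) p r" "refines (vertices k) q r" for r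
  proof -
    have r: "partition_on (vertices k) r" using that by (simp add: refines_def)
    have "?R \<subseteq> block_rel r"
      using that by (simp add: refines_iff_block_rel pq r)
    from conn_Int_block_rel[OF r this] show ?thesis
      by (simp add: refines_iff_block_rel comp r)
  qed
  show ?thesis
    unfolding join_part_def
  proof (rule the_equality)
    fix r assume "refines (vertices k) p r \<and> refines (vertices k) q r \<and>
      (\<forall>s. refines (vertices k) p s \<and> refines (vertices k) q s \<longrightarrow> refines (vertices k) r s)"
    then show "r = vertices k // conn ?R"
      using upper least[of r] refines_asym[of "vertices k" r] by simp
  qed (simp add: upper least)
qed

lemma nc_join_part:
  assumes "p \<in> partitions k" "q \<in> partitions k"
  shows "nc (join_part k p q) = ncomp (vertices k) (block_rel p \<union> block_rel q)"
  by (simp add: nc_def ncomp_def join_part_eq[OF assms])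

lemma nc_eq_ncomp: "p \<in> partitions k \<Longrightarrow> nc p = ncomp (vertices k) (block_rel p)"
  by (simp add: nc_def ncomp_def quotient_conn_block_rel[OF partitionsD])

lemma join_part_commute:
  "p \<in> partitions k \<Longrightarrow> q \<in> partitions k \<Longrightarrow> join_part k p q = join_part k q p"
  by (simp add: join_part_eq Un_commute)

lemma nc_join_part_le:
  assumes "p \<in> partitions k" "q \<in> partitions k"
  shows "nc (join_part k p q) \<le> nc p"
  unfolding nc_join_part[OF assms] nc_eq_ncomp[OF assms(1)]
  by (rule ncomp_mono) (auto intro: conn_base)

lemma block_rel_subset_if_nc_join_part_eq:
  assumes "p \<in> partitions k" "q \<in> partitions k" "nc (join_part k p q) = nc p"
  shows "block_rel q \<subseteq> block_rel p"
proof -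
  have "block_rel q \<subseteq> conn (block_rel p)"
    using assms nc_join_part nc_eq_ncomp partitions_block_rel_subset
    by (intro ncomp_Un_eqD[of "vertices k"]) auto
  then show ?thesis
    using conn_Int_block_rel[OF partitionsD[OF assms(1)] order.refl]
      partitions_block_rel_subset[OF assms(2)] by blast
qed

text \<open>The distance is the mean of \<open>nc p - nc (p \<or> q)\<close> and
  \<open>nc q - nc (p \<or> q)\<close>, both nonnegative. If both vanish, the partitions refine each
  other. This later makes the rank strictly monotone.\<close>

lemma dist_part_pos:
  assumes "p \<in> partitions k" "q \<in> partitions k" "p \<noteq> q"
  shows "dist_part k p q > 0"
proof (rule ccontr)
  assume "\<not> dist_part k p q > 0"
  then have "nc (join_part k p q) = nc p" "nc (join_part k q p) = nc q"
    using nc_join_part_le[of p k q] nc_join_part_le[of q k p] assms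
    by (auto simp: dist_part_def join_part_commute[of q k p])
  then have "block_rel p = block_rel q"
    using block_rel_subset_if_nc_join_part_eq assms by blast
  then show False
    using block_rel_inject partitionsD assms by metis
qed

text \<open>This is \<open>d(id, p') + d(p', p) - d(id, p)\<close>; the subtraction is never truncated
  by \<open>defect_eq\<close>.\<close>

definition defect :: "nat \<Rightarrow> vertex set set \<Rightarrow> vertex set set \<Rightarrow> nat" where
  "defect k p' p = nc p' + nc (join_part k p (id_part k))
     - (nc (join_part k p' (id_part k)) + nc (join_part k p' p))"

text \<open>Supermodularity over the base graph of \<open>p'\<close>, with \<open>p\<close> and the
  identity as the two additions, followed by omitting \<open>p'\<close> from the triple join. In
  terms of distances this is the triangle inequality through \<open>p'\<close>.\<close>

lemma defect_eq:
  assumes p': "p' \<in> partitions k" and p: "p \<in> partitions k"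
  shows "defect k p' p + (nc (join_part k p' (id_part k)) + nc (join_part k p' p))
    = nc p' + nc (join_part k p (id_part k))"
proof -
  note id = id_part_in_partitions[of k]
  let ?V = "vertices k" and ?p = "block_rel p" and ?p' = "block_rel p'" and ?i = "block_rel (id_part k)"
  have "ncomp ?V (?p' \<union> ?p) + ncomp ?V (?p' \<union> ?i) \<le> ncomp ?V ?p' + ncomp ?V (?p' \<union> ?p \<union> ?i)"
    by (rule ncomp_supermodular) (simp_all add: partitions_block_rel_subset id)
  also have "ncomp ?V (?p' \<union> ?p \<union> ?i) \<le> ncomp ?V (?p \<union> ?i)"
    by (rule ncomp_mono) (auto intro: conn_base)
  finally show ?thesis
    by (simp add: defect_def nc_join_part nc_eq_ncomp[OF p'] p p' id)
qed

lemma dist_part_triangle_defect: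
  assumes "p' \<in> partitions k" "p \<in> partitions k"
  shows "dist_part k (id_part k) p' + dist_part k p' p = dist_part k (id_part k) p + real (defect k p' p)"
proof -
  have "real (defect k p' p) + (real (nc (join_part k p' (id_part k))) + real (nc (join_part k p' p)))
    = real (nc p') + real (nc (join_part k p (id_part k)))"
    using defect_eq[OF assms] by (metis of_nat_add)
  then show ?thesis
    using assms by (simp add: dist_part_def join_part_commute[OF id_part_in_partitions] field_simps)
qed

lemma geodesic_le_iff_defect:
  assumes "p' \<in> partitions k" "p \<in> partitions k"
  shows "geodesic_le k p' p \<longleftrightarrow> defect k p' p = 0"
  using dist_part_triangle_defect[OF assms] by (simp add: geodesic_le_def)

section \<open>The trace of a product of diagrams\<close>

lemma map_prod_image_subset:
  assumes "R \<subseteq> V \<times> V" "f ` V \<subseteq> W"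
  shows "map_prod f f ` R \<subseteq> W \<times> W"
proof -
  have "map_prod f f ` R \<subseteq> f ` V \<times> f ` V"
    using image_mono[OF assms(1), of "map_prod f f"] by (simp add: map_prod_surj_on[OF refl refl])
  then show ?thesis using assms(2) by blast
qed

lemma block_rel_image:
  "block_rel ((\<lambda>B. f ` B) ` p) = map_prod f f ` block_rel p"
  by (simp add: block_rel_def image_UN map_prod_surj_on[OF refl refl])

lemma block_rel_vimage:
  "block_rel ((\<lambda>B. f -` B) ` p - {{}}) = {(x, y). (f x, f y) \<in> block_rel p}"
  by (auto simp: block_rel_def)

lemma transpose_part_in_partitions:
  assumes "p \<in> partitions k"
  shows "transpose_part p \<in> partitions k"
proof -
  have inj: "inj flip_vertex"
  proof (rule injI)
    fix x y show "flip_vertex x = flip_vertex y \<Longrightarrow> x = y" by (cases x; cases y) auto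
  qed
  have "flip_vertex ` vertices k = vertices k"
    by (simp add: vertices_def image_Un image_image Un_commute)
  moreover have "partition_on (flip_vertex ` vertices k) ((`) flip_vertex ` p - {{}})"
    using partition_on_inj_image[OF partitionsD[OF assms]] inj by (meson inj_on_subset subset_UNIV)
  moreover have "{} \<notin> (`) flip_vertex ` p"
    using partition_onD3[OF partitionsD[OF assms]] by auto
  ultimately show ?thesis
    by (simp add: partitions_def transpose_part_def)
qed

lemma transpose_part_involutive: "transpose_part (transpose_part p) = p"
proof -
  have "flip_vertex (flip_vertex x) = x" for x by (cases x) auto
  then show ?thesis by (simp add: transpose_part_def image_image)
qed

lemma stacked_edges_eq:
  "stacked_edges p q = map_prod place_above place_above ` block_rel q
     \<union> map_prod place_below place_below ` block_rel p"
  by (simp add: stacked_edges_def block_rel_def image_UN map_prod_surj_on[OF refl refl])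

lemma place_outer_vertices: "place_outer ` vertices k = Upper ` {1..k} \<union> Lower ` {1..k}"
  by (simp add: vertices_def image_Un image_image)

lemma stacked_edges_subset:
  assumes "p \<in> partitions k" "q \<in> partitions k"
  shows "stacked_edges p q \<subseteq> stacked_vertices k \<times> stacked_vertices k"
proof -
  have "place_above ` vertices k \<subseteq> stacked_vertices k" "place_below ` vertices k \<subseteq> stacked_vertices k"
    by (auto simp: vertices_def stacked_vertices_def)
  with assms[THEN partitions_block_rel_subset] show ?thesis
    unfolding stacked_edges_eq by (intro Un_least map_prod_image_subset)
qed

lemma stacked_components_eq: "stacked_components k p q = stacked_vertices k // conn (stacked_edges p q)"
proof -
  have "sym (stacked_edges p q)" by (auto simp: stacked_edges_def sym_def)
  then show ?thesis by (simp add: stacked_components_def conn_sym_eq)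
qed

lemma comp_part_in_partitions:
  assumes "p \<in> partitions k" "q \<in> partitions k"
  shows "comp_part k p q \<in> partitions k"
proof -
  have "place_outer -` stacked_vertices k = vertices k" (is "?L = ?R")
  proof (rule set_eqI)
    fix x show "x \<in> ?L \<longleftrightarrow> x \<in> ?R" by (cases x) (auto simp: stacked_vertices_def vertices_def)
  qed
  moreover have "partition_on (stacked_vertices k) (stacked_components k p q)"
    unfolding stacked_components_eq
    by (rule partition_on_components(1)[OF stacked_edges_subset[OF assms]])
  ultimately show ?thesis
    using partition_on_vimage[of "stacked_vertices k" _ place_outer]
    by (simp add: comp_part_def partitions_def)
qed

lemma block_rel_comp_part:
  assumes "p \<in> partitions k" "q \<in> partitions k"
  shows "block_rel (comp_part k p q) = {(x, y). x \<in> vertices k \<and> y \<in> vertices k \<and>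
    (place_outer x, place_outer y) \<in> conn (stacked_edges p q)}"
proof -
  have "place_outer x \<in> stacked_vertices k \<longleftrightarrow> x \<in> vertices k" for x
    by (cases x) (auto simp: stacked_vertices_def vertices_def)
  then show ?thesis
    unfolding comp_part_def block_rel_vimage stacked_components_eq
      partition_on_components(2)[OF stacked_edges_subset[OF assms]] by auto
qed

text \<open>Gluing the lower row to the upper row in the diagram of \<open>p \<circ> q\<close> and reading the middle row
  as the top row gives a diagram of \<open>p \<or> \<^sup>tq\<close>.\<close>

fun close_up :: "stacked \<Rightarrow> vertex" where
  "close_up (Middle i) = Top i"
| "close_up (Upper i) = Bot i"
| "close_up (Lower i) = Bot i"

text \<open>Both sides count the components of the stacked diagram with each \<open>Upper j\<close>
  tied to \<open>Lower j\<close>: splitting off the loops gives the left side, contracting along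
  \<open>close_up\<close> gives the right side.\<close>

lemma loops_add_nc_comp_part:
  assumes p: "p \<in> partitions k" and q: "q \<in> partitions k"
  shows "loops k p q + nc (join_part k (comp_part k p q) (id_part k))
    = nc (join_part k p (transpose_part q))"
proof -
  let ?V = "vertices k" and ?S = "stacked_vertices k" and ?G = "stacked_edges p q"
  let ?W = "place_outer ` ?V" and ?i = "block_rel (id_part k)"
  \<comment> \<open>The tying edges are the identity partition transported to the outer
    rows.\<close>
  let ?J = "map_prod place_outer place_outer ` ?i"
  let ?R = "block_rel p \<union> block_rel (transpose_part q)"
  have i: "?i \<subseteq> ?V \<times> ?V"
    by (rule partitions_block_rel_subset[OF id_part_in_partitions])
  have W: "?W \<subseteq> ?S" "finite ?S"
    by (auto simp: place_outer_vertices stacked_vertices_def)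
  have J: "?J \<subseteq> ?W \<times> ?W" using i by (rule map_prod_image_subset) simp
  have sub: "?G \<union> ?J \<subseteq> ?S \<times> ?S"
    using J W stacked_edges_subset[OF p q] by blast
  have "loops k p q = card {C \<in> ?S // conn ?G. C \<inter> ?W = {}}"
  proof -
    have "C \<subseteq> ?S" if "C \<in> ?S // conn ?G" for C
      using that partition_onD1[OF partition_on_components(1)[OF stacked_edges_subset[OF p q]]] by blast
    moreover have "?S - ?W = Middle ` {1..k}"
      by (auto simp: place_outer_vertices stacked_vertices_def)
    ultimately have "C \<subseteq> Middle ` {1..k} \<longleftrightarrow> C \<inter> ?W = {}" if "C \<in> ?S // conn ?G" for C
      using that by blast
    then show ?thesis
      unfolding loops_def stacked_components_eq by (intro arg_cong[where f = card] Collect_cong) blast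
  qed
  moreover have "nc (join_part k (comp_part k p q) (id_part k)) = ncomp ?W (?G \<union> ?J)"
    unfolding nc_join_part[OF comp_part_in_partitions[OF p q] id_part_in_partitions] ncomp_def
  proof (rule card_quotient_eq[where f = place_outer])
    show "(x, y) \<in> conn (block_rel (comp_part k p q) \<union> ?i) \<longleftrightarrow>
        (place_outer x, place_outer y) \<in> conn (?G \<union> ?J)" if "x \<in> ?V" "y \<in> ?V" for x y
      unfolding conn_restrict[OF i that] block_rel_comp_part[OF p q] ..
    show "\<exists>x\<in>?V. (place_outer x, w) \<in> conn (?G \<union> ?J)" if "w \<in> ?W" for w
    proof -
      from that obtain x where "x \<in> ?V" "w = place_outer x" by (rule imageE)
      then show ?thesis by (intro bexI[of _ x]) simp_all
    qed
  qed simp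
  moreover have "ncomp ?S (?G \<union> ?J) = nc (join_part k p (transpose_part q))"
    unfolding nc_join_part[OF p transpose_part_in_partitions[OF q]] ncomp_def
  proof (rule card_quotient_eq[where f = close_up])
    have below: "close_up (place_below x) = x" for x by (cases x) auto
    have above: "close_up (place_above x) = flip_vertex x" for x by (cases x) auto
    \<comment> \<open>The tying edges collapse to pairs \<open>(Bot j, Bot j)\<close>, already
      present by reflexivity, so they add nothing to the contracted graph.\<close>
    have "map_prod close_up close_up ` ?J \<subseteq> block_rel p"
    proof
      fix z assume "z \<in> map_prod close_up close_up ` ?J"
      then obtain x y where xy: "(x, y) \<in> ?i" "z = (close_up (place_outer x), close_up (place_outer y))"
        by auto
      from xy(1) obtain j where "j \<in> {1..k}" "x \<in> {Top j, Bot j}" "y \<in> {Top j, Bot j}"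
        by (auto simp: block_rel_def id_part_def)
      then have "Bot j \<in> vertices k" "z = (Bot j, Bot j)"
        using xy(2) by (auto simp: vertices_def)
      then show "z \<in> block_rel p"
        using equiv_block_rel[OF partitionsD[OF p]] by (simp add: equiv_def refl_on_def)
    qed
    moreover have "map_prod close_up close_up ` ?G = ?R"
      by (simp add: stacked_edges_eq image_Un image_image map_prod_def case_prod_unfold below above
          transpose_part_def block_rel_image Un_commute)
    ultimately have image: "map_prod close_up close_up ` (?G \<union> ?J) = ?R"
      by (auto simp: image_Un)
    \<comment> \<open>Distinct vertices are identified only when they are \<open>Upper j\<close> and
      \<open>Lower j\<close>, which \<open>?J\<close> joins.\<close>
    have ker: "(x, y) \<in> conn (?G \<union> ?J)" if "x \<in> ?S" "y \<in> ?S" "close_up x = close_up y" for x y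
    proof -
      have "(Upper j, Lower j) \<in> ?J" if "j \<in> {1..k}" for j
        using that by (intro rev_image_eqI[of "(Top j, Bot j)"]) (auto simp: block_rel_def id_part_def)
      then have "(Upper j, Lower j) \<in> conn (?G \<union> ?J)" "(Lower j, Upper j) \<in> conn (?G \<union> ?J)"
        if "j \<in> {1..k}" for j
        using that by (simp_all add: conn_base conn_base_sym)
      then show ?thesis
        using that by (cases x; cases y) (auto simp: stacked_vertices_def)
    qed
    show "(x, y) \<in> conn (?G \<union> ?J) \<longleftrightarrow> (close_up x, close_up y) \<in> conn ?R"
      if "x \<in> ?S" "y \<in> ?S" for x y
      unfolding image[symmetric] using sub that ker by (rule conn_contract)
    show "close_up x \<in> ?V" if "x \<in> ?S" for x
      using that by (auto simp: stacked_vertices_def vertices_def)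
    show "\<exists>x\<in>?S. (close_up x, w) \<in> conn ?R" if "w \<in> ?V" for w
    proof
      show "(close_up (place_below w), w) \<in> conn ?R" by (simp add: below)
      show "place_below w \<in> ?S"
        using that by (auto simp: stacked_vertices_def vertices_def)
    qed
  qed
  ultimately show ?thesis
    using ncomp_Un_split[OF W(2) W(1) J, of ?G] by simp
qed

section \<open>Traces and moments in coordinates\<close>

lemma Tr_part_basis_vec:
  assumes "p \<in> partitions k"
  shows "Tr_part k N (basis_vec p) = of_nat N ^ nc (join_part k p (id_part k))"
proof -
  have "Tr_part k N (basis_vec p) =
      (\<Sum>q\<in>partitions k. if q = p then of_nat N ^ nc (join_part k q (id_part k)) else 0)"
    unfolding Tr_part_def basis_vec_def by (rule sum.cong) auto
  then show ?thesis using assms by simp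
qed

text \<open>By linearity each basis product contributes a power of \<open>N\<close> for its loops
  times the trace of the composition; the exponents add up by
  \<open>loops_add_nc_comp_part\<close>.\<close>

lemma Tr_part_mult_basis_vec:
  assumes q: "q \<in> partitions k"
  shows "Tr_part k N (part_mult k N E (basis_vec q)) =
    (\<Sum>p\<in>partitions k. E p * of_nat N ^ nc (join_part k p (transpose_part q)))"
proof -
  let ?w = "\<lambda>r. of_nat N ^ nc (join_part k r (id_part k)) :: complex"
  have mult: "part_mult k N E (basis_vec q) r =
      (\<Sum>p\<in>partitions k. E p * of_nat N ^ loops k p q * basis_vec (comp_part k p q) r)" for r
  proof -
    have "(\<Sum>p\<^sub>2\<in>partitions k. E p * basis_vec q p\<^sub>2 *
          (of_nat N ^ loops k p p\<^sub>2 * basis_vec (comp_part k p p\<^sub>2) r)) =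
        (\<Sum>p\<^sub>2\<in>partitions k. if p\<^sub>2 = q
          then E p * of_nat N ^ loops k p p\<^sub>2 * basis_vec (comp_part k p p\<^sub>2) r else 0)" for p
      by (rule sum.cong) (auto simp: basis_vec_def[of q])
    then show ?thesis using q by (simp add: part_mult_def)
  qed
  have "Tr_part k N (part_mult k N E (basis_vec q)) =
      (\<Sum>r\<in>partitions k. \<Sum>p\<in>partitions k.
        E p * of_nat N ^ loops k p q * (basis_vec (comp_part k p q) r * ?w r))"
    by (simp add: Tr_part_def mult sum_distrib_right mult.assoc)
  also have "\<dots> = (\<Sum>p\<in>partitions k. E p * of_nat N ^ loops k p q * Tr_part k N (basis_vec (comp_part k p q)))"
    by (subst sum.swap) (simp add: Tr_part_def sum_distrib_left)
  also have "\<dots> = (\<Sum>p\<in>partitions k. E p * of_nat N ^ nc (join_part k p (transpose_part q)))"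
    by (rule sum.cong)
      (simp_all add: Tr_part_basis_vec comp_part_in_partitions q mult.assoc
        flip: loops_add_nc_comp_part power_add)
  finally show ?thesis .
qed

text \<open>The two transpositions cancel, leaving the exponent
  \<open>nc (p' \<or> p) - nc (p \<or> id)\<close>. By \<open>defect_eq\<close> this is the exponent
  in the cumulant on \<open>p'\<close> minus the defect.\<close>

lemma moment_eq_sum_cumulant:
  assumes p: "p \<in> partitions k" and N: "N \<ge> 1"
  shows "moment k N p E = (\<Sum>p'\<in>partitions k. (1 / of_nat N) ^ defect k p' p * cumulant k N p' E)"
proof -
  have N0: "(of_nat N :: complex) \<noteq> 0" using N by simp
  let ?j = "\<lambda>p. nc (join_part k p (id_part k))"
  have "1 / of_nat N ^ ?j p * (E p' * of_nat N ^ nc (join_part k p' p)) =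
      (1 / of_nat N) ^ defect k p' p * cumulant k N p' E" if p': "p' \<in> partitions k" for p'
  proof -
    have "of_nat N ^ defect k p' p * (of_nat N ^ ?j p' * of_nat N ^ nc (join_part k p' p)) =
        of_nat N ^ nc p' * (of_nat N ^ ?j p :: complex)"
      unfolding power_add[symmetric] defect_eq[OF p' p] ..
    then show ?thesis
      using N0 by (simp add: cumulant_def power_int_diff field_simps)
  qed
  then show ?thesis
    by (simp add: moment_def Tr_part_basis_vec p Tr_part_mult_basis_vec transpose_part_in_partitions
        transpose_part_involutive sum_distrib_left cong: sum.cong)
qed

section \<open>Convergence\<close>

lemma inverse_power_limit:
  "(\<lambda>N. (1 / of_nat N :: complex) ^ d) \<longlonglongrightarrow> (if d = 0 then 1 else 0)"
proof (cases "d = 0")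
  case False
  have "(\<lambda>N. (1 / of_nat N :: complex) ^ d) \<longlonglongrightarrow> 0 ^ d"
    by (intro tendsto_power lim_1_over_n)
  with False show ?thesis by (simp add: zero_power)
qed simp

text \<open>Gaussian elimination: pivoting on the index of largest rank perturbs the remaining rows by
  terms that tend to 0.\<close>

lemma triangular_system_convergent:
  fixes a :: "nat \<Rightarrow> 'i \<Rightarrow> 'i \<Rightarrow> 'b::real_normed_field" and rank :: "'i \<Rightarrow> 'r::linorder"
  assumes "finite S"
    and "\<And>i j. i \<in> S \<Longrightarrow> j \<in> S \<Longrightarrow> (\<lambda>n. a n i j) \<longlonglongrightarrow> l i j"
    and "\<And>i. i \<in> S \<Longrightarrow> l i i \<noteq> 0"
    and "\<And>i j. i \<in> S \<Longrightarrow> j \<in> S \<Longrightarrow> i \<noteq> j \<Longrightarrow> l i j \<noteq> 0 \<Longrightarrow> rank j < rank i"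
    and "\<And>i. i \<in> S \<Longrightarrow> \<forall>\<^sub>F n in sequentially. (\<Sum>j\<in>S. a n i j * x n j) = y n i"
    and "\<And>i. i \<in> S \<Longrightarrow> convergent (\<lambda>n. y n i)"
  shows "\<forall>i\<in>S. convergent (\<lambda>n. x n i)"
  using assms
proof (induction S arbitrary: a y rule: finite_ranking_induct[where f = rank])
  case empty
  then show ?case by simp
next
  case (insert m S)
  show ?case
  proof (cases "m \<in> S")
    \<comment> \<open>The induction rule also admits an index that is already present; then there is
      nothing to eliminate.\<close>
    case True
    then have S: "insert m S = S" by auto
    show ?thesis using insert.prems unfolding S by (rule insert.IH)
  next
    case False
    note lim = insert.prems(1) and diag = insert.prems(2) and tri = insert.prems(3)
      and row = insert.prems(4) and conv = insert.prems(5)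
    \<comment> \<open>The multiplier of row \<open>m\<close> that clears column \<open>m\<close> in
      row \<open>i\<close>.\<close>
    define c where "c n i = a n i m / a n m m" for n i
    \<comment> \<open>A nonzero entry would force \<open>rank m < rank i\<close>, but
      \<open>m\<close> has maximal rank.\<close>
    have l0: "l i m = 0" if "i \<in> S" for i
      using tri[of i m] insert.hyps(2)[OF that] that False by force
    have c: "(\<lambda>n. c n i) \<longlonglongrightarrow> 0" if "i \<in> S" for i
      using tendsto_divide[OF lim[of i m] lim[of m m] diag] l0[OF that] that by (simp add: c_def)
    have pivot: "\<forall>\<^sub>F n in sequentially. a n m m \<noteq> 0"
      using tendsto_imp_eventually_ne[OF lim[of m m] diag] by simp
    have rowm: "\<forall>\<^sub>F n in sequentially. a n m m * x n m + (\<Sum>j\<in>S. a n m j * x n j) = y n m"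
      using row[of m] insert.hyps(1) False by simp
    \<comment> \<open>The reduced matrix has the same limit \<open>l\<close> on \<open>S\<close>
      because the multipliers tend to 0, so the hypotheses on diagonal and rank carry over.\<close>
    have S: "\<forall>i\<in>S. convergent (\<lambda>n. x n i)"
    proof (rule insert.IH[of "\<lambda>n i j. a n i j - c n i * a n m j" "\<lambda>n i. y n i - c n i * y n m"])
      show "(\<lambda>n. a n i j - c n i * a n m j) \<longlonglongrightarrow> l i j" if "i \<in> S" "j \<in> S" for i j
        using tendsto_diff[OF lim[of i j] tendsto_mult[OF c[of i] lim[of m j]]] that by simp
      show "\<forall>\<^sub>F n in sequentially.
          (\<Sum>j\<in>S. (a n i j - c n i * a n m j) * x n j) = y n i - c n i * y n m" if "i \<in> S" for i
      proof -
        have "\<forall>\<^sub>F n in sequentially. a n i m * x n m + (\<Sum>j\<in>S. a n i j * x n j) = y n i"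
          using row[of i] insert.hyps(1) False that by simp
        with pivot rowm show ?thesis
        proof eventually_elim
          case (elim n)
          have "c n i * a n m m = a n i m" using elim(1) by (simp add: c_def)
          then show ?case
            unfolding elim(2,3)[symmetric]
            by (simp add: left_diff_distrib sum_subtractf sum_distrib_left mult.assoc[symmetric] distrib_left)
        qed
      qed
      show "convergent (\<lambda>n. y n i - c n i * y n m)" if "i \<in> S" for i
        using that by (intro convergent_diff convergent_mult conv) (auto intro: c convergentI)
    qed (use diag tri in auto)
    \<comment> \<open>Back substitution: row \<open>m\<close> solved for its pivot variable.\<close>
    have "convergent (\<lambda>n. (y n m - (\<Sum>j\<in>S. a n m j * x n j)) / a n m m)"
    proof -
      have "convergent (\<lambda>n. a n m j * x n j)" if "j \<in> S" for j
        using that S lim[of m j] by (intro convergent_mult) (auto intro: convergentI)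
      then have "convergent (\<lambda>n. y n m - (\<Sum>j\<in>S. a n m j * x n j))"
        by (intro convergent_diff conv convergent_sum) auto
      then show ?thesis
        using tendsto_divide[OF _ lim[of m m] diag] by (auto simp: convergent_def)
    qed
    moreover have "\<forall>\<^sub>F n in sequentially. (y n m - (\<Sum>j\<in>S. a n m j * x n j)) / a n m m = x n m"
      using pivot rowm by eventually_elim (auto simp: field_simps)
    ultimately have "convergent (\<lambda>n. x n m)"
      using convergent_cong by fast
    with S show ?thesis by simp
  qed
qed

theorem theorem5p1:
  fixes k :: nat and E :: "nat \<Rightarrow> part_vec"
  assumes "\<And>N. N \<ge> 1 \<Longrightarrow> E N \<in> part_algebra k"
  shows "(converges_in_moments k E \<longleftrightarrow>
            (\<forall>p\<in>partitions k. convergent (\<lambda>N. cumulant k N p (E N)))) \<and>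
         (converges_in_moments k E \<longrightarrow>
            (\<forall>p\<in>partitions k.
               limit_moment k E p =
                 (\<Sum>p'\<in>{p'\<in>partitions k. geodesic_le k p' p}. limit_cumulant k E p')))"
proof -
  let ?a = "\<lambda>N p p'. (1 / of_nat N :: complex) ^ defect k p' p"
  let ?l = "\<lambda>p p'. if defect k p' p = 0 then 1 else 0 :: complex"
  \<comment> \<open>Holds only eventually, as the expansion divides by powers of \<open>N\<close>
    and so excludes \<open>N = 0\<close>.\<close>
  have row: "\<forall>\<^sub>F N in sequentially. (\<Sum>p'\<in>partitions k. ?a N p p' * cumulant k N p' (E N)) = moment k N p (E N)"
    if "p \<in> partitions k" for p
    using eventually_ge_at_top[of 1] by eventually_elim (simp add: moment_eq_sum_cumulant that)
  have cumulants: "\<forall>p\<in>partitions k. convergent (\<lambda>N. cumulant k N p (E N))"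
    if "converges_in_moments k E"
  proof (rule triangular_system_convergent[where a = ?a and l = ?l
        and rank = "dist_part k (id_part k)" and y = "\<lambda>N p. moment k N p (E N)"])
    fix p p' assume pp': "p \<in> partitions k" "p' \<in> partitions k"
    show "(\<lambda>N. ?a N p p') \<longlonglongrightarrow> ?l p p'" by (rule inverse_power_limit)
    show "dist_part k (id_part k) p' < dist_part k (id_part k) p" if "p \<noteq> p'" "?l p p' \<noteq> 0"
    proof -
      \<comment> \<open>Zero defect puts \<open>p'\<close> on a geodesic from the identity to
        \<open>p\<close>, and the positive distance from \<open>p'\<close> to \<open>p\<close> makes
        its rank strictly smaller.\<close>
      have "defect k p' p = 0" using that(2) by (simp split: if_splits)
      then show ?thesis
        using dist_part_triangle_defect[OF pp'(2,1)] dist_part_pos[OF pp'(2,1)] that(1) by simp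
    qed
  next
    fix p assume p: "p \<in> partitions k"
    \<comment> \<open>The join of \<open>p\<close> with itself is \<open>p\<close>, so the two sums
      in the defect agree.\<close>
    have "defect k p p = 0"
      by (simp add: defect_def join_part_eq[OF p p] quotient_conn_block_rel[OF partitionsD[OF p]])
    then show "?l p p \<noteq> 0" by simp
    show "convergent (\<lambda>N. moment k N p (E N))"
      using that p by (simp add: converges_in_moments_def)
  qed (simp_all add: row)
  \<comment> \<open>Assuming convergence of the cumulants here serves twice: for the converse
    implication and for the limit formula.\<close>
  have limit: "(\<lambda>N. moment k N p (E N)) \<longlonglongrightarrow>
      (\<Sum>p'\<in>{p'\<in>partitions k. geodesic_le k p' p}. limit_cumulant k E p')"
    if conv: "\<forall>p\<in>partitions k. convergent (\<lambda>N. cumulant k N p (E N))" and p: "p \<in> partitions k" for p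
  proof -
    have "(\<lambda>N. \<Sum>p'\<in>partitions k. ?a N p p' * cumulant k N p' (E N)) \<longlonglongrightarrow>
        (\<Sum>p'\<in>partitions k. ?l p p' * limit_cumulant k E p')"
      using conv unfolding limit_cumulant_def convergent_LIMSEQ_iff
      by (intro tendsto_sum tendsto_mult inverse_power_limit) auto
    moreover have "(\<Sum>p'\<in>partitions k. ?l p p' * limit_cumulant k E p') =
        (\<Sum>p'\<in>{p'\<in>partitions k. geodesic_le k p' p}. limit_cumulant k E p')"
    \<comment> \<open>The terms off the geodesics have positive defect, hence limiting coefficient
      0; the remaining coefficients are 1.\<close>
    proof (rule sum.mono_neutral_cong_right)
      show "\<forall>p'\<in>partitions k - {p' \<in> partitions k. geodesic_le k p' p}. ?l p p' * limit_cumulant k E p' = 0"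
        using p by (auto simp: geodesic_le_iff_defect)
      show "?l p p' * limit_cumulant k E p' = limit_cumulant k E p'"
        if "p' \<in> {p' \<in> partitions k. geodesic_le k p' p}" for p'
        using that p by (auto simp: geodesic_le_iff_defect)
    qed auto
    ultimately show ?thesis
      using Lim_transform_eventually row[OF p] by force
  qed
  have "converges_in_moments k E"
    if "\<forall>p\<in>partitions k. convergent (\<lambda>N. cumulant k N p (E N))"
    using limit[OF that] by (auto simp: converges_in_moments_def intro: convergentI)
  moreover have "limit_moment k E p =
      (\<Sum>p'\<in>{p'\<in>partitions k. geodesic_le k p' p}. limit_cumulant k E p')"
    if "converges_in_moments k E" "p \<in> partitions k" for p
    unfolding limit_moment_def using that by (intro limI limit cumulants)
  ultimately show ?thesis using cumulants by blast
qed

end
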